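(* Let $f:\mathbb{R}^n\times\mathbb{R}^l\to\overline{\mathbb{R}}$ be lower semicontinuous and finite at $(\bar x,\bar y)$. Given a direction $(h,\nu)\in\mathbb{R}^n\times\mathbb{R}$, assume that the set-valued mapping $F:\mathbb{R}^{n+1}\rightrightarrows\mathbb{R}^{n+l+1}$, $F(x,\alpha)=\mathrm{epi}\,f-(x,\bar y,\alpha)$, is metrically subregular at $((\bar x,f(\bar x,\bar y)),(0,0,0))$ in direction $(h,\nu)$. Then $$\partial_xf((\bar x,\bar y);(h,\nu))\subset\{x^*\mid\exists y^*\text{ with }(x^*,y^* )\in\partial f((\bar x,\bar y);(h,0,\nu))\}.$$
   Context: Euclidean norms are used; $\mathbb{B}$ is the closed unit ball; $t_k\downarrow0$ means $t_k>0$, $t_k\to0$; $d_A(x)$ is the distance from $x$ to $A$ ($d_\emptyset=\infty$); $\overline{\mathbb{R}}=\mathbb{R}\cup\{\pm\infty\}$. For $\Omega\subset\mathbb{R}^N$ and $x\in\Omega$: $\hat N_\Omega(x)=\{\xi\mid\limsup_{x'\to x,\,x'\in\Omega}\langle\xi,x'-x\rangle/\|x'-x\|\le0\}$, empty if $x\notin\Omega$. The limiting normal cone in direction $u$ is $N_\Omega(x;u)=\{\xi\mid\exists t_k\downarrow0,\ u_k\to u,\ \xi_k\to\xi:\ \xi_k\in\hat N_\Omega(x+t_ku_k)\ \forall k\}$. For $f:\mathbb{R}^N\to\overline{\mathbb{R}}$ finite at $z$: $\mathrm{epi}\,f=\{(w,\alpha)\in\mathbb{R}^{N+1}\mid\alpha\ge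 f(w)\}$ and, for $(u,\mu)\in\mathbb{R}^{N+1}$, $\partial f(z;(u,\mu))=\{\xi\mid(\xi,-1)\in N_{\mathrm{epi}\,f}((z,f(z));(u,\mu))\}$. In $\partial f((\bar x,\bar y);(h,0,\nu))$ the direction is $(h,0)$ in the domain and $\nu$ in the range. The partial subdifferential of $f$ with respect to $x$ at $\bar x$ for $\bar y$ in direction $(h,\nu)$ is $\partial_xf((\bar x,\bar y);(h,\nu)):=\partial f_x(\bar x;(h,\nu))$ with $f_x:=f(\cdot,\bar y)$. A directional neighborhood of $u$ is a set containing $\mathcal{V}_{\rho,\delta}(u):=\{z\in\rho\mathbb{B}\mid\big\|\|u\|z-\|z\|u\big\|\le\delta\|z\|\|u\|\}$ for some $\rho,\delta>0$. A multifunction $F$ is metrically subregular at $(\bar z,\bar w)\in\mathrm{gph}\,F$ in direction $u$ if there are $\kappa>0$ and a directional neighborhood $\mathcal{U}$ of $u$ with $d_{F^{-1}(\bar w)}(z)\le\kappa\,d_{F(z)}(\bar w)$ for all $z\in\bar z+\mathcal{U}$. *)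

theory Defs
  imports "HOL-Analysis.Analysis"
begin

text \<open>At an isolated point of \<open>\<Omega>\<close> the filter is trivial, \<open>Limsup\<close> is \<open>- \<infinity>\<close>, and every vector is a
  regular normal.\<close>

definition regular_normal_cone :: "'a::real_inner set \<Rightarrow> 'a \<Rightarrow> 'a set" where
  "regular_normal_cone \<Omega> x =
     (if x \<in> \<Omega>
      then {\<xi>. Limsup (at x within \<Omega>) (\<lambda>x'. ereal ((\<xi> \<bullet> (x' - x)) / norm (x' - x))) \<le> 0}
      else {})"

definition limiting_normal_cone_dir :: "'a::real_inner set \<Rightarrow> 'a \<Rightarrow> 'a \<Rightarrow> 'a set" where
  "limiting_normal_cone_dir \<Omega> x u =
     {\<xi>. \<exists>(t :: nat \<Rightarrow> real) (u' :: nat \<Rightarrow> 'a) (\<xi>' :: nat \<Rightarrow> 'a).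
           (\<forall>k. t k > 0) \<and> t \<longlonglongrightarrow> 0 \<and> u' \<longlonglongrightarrow> u \<and> \<xi>' \<longlonglongrightarrow> \<xi> \<and>
           (\<forall>k. \<xi>' k \<in> regular_normal_cone \<Omega> (x + t k *\<^sub>R u' k))}"

definition epi :: "('a \<Rightarrow> ereal) \<Rightarrow> ('a \<times> real) set" where
  "epi f = {(w, \<alpha>). f w \<le> ereal \<alpha>}"

text \<open>Meaningful only if \<open>f z\<close> is finite, so that \<open>real_of_ereal (f z)\<close> is the value of \<open>f\<close> at \<open>z\<close>.\<close>

definition subdifferential_dir ::
    "('a::real_inner \<Rightarrow> ereal) \<Rightarrow> 'a \<Rightarrow> 'a \<times> real \<Rightarrow> 'a set" where
  "subdifferential_dir f z d =
     {\<xi>. (\<xi>, -1) \<in> limiting_normal_cone_dir (epi f) (z, real_of_ereal (f z)) d}"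

definition partial_subdifferential_dir ::
    "('a::real_inner \<times> 'b \<Rightarrow> ereal) \<Rightarrow> 'a \<times> 'b \<Rightarrow> 'a \<times> real \<Rightarrow> 'a set" where
  "partial_subdifferential_dir f z d = subdifferential_dir (\<lambda>x. f (x, snd z)) (fst z) d"

definition lower_semicontinuous :: "('a::topological_space \<Rightarrow> ereal) \<Rightarrow> bool" where
  "lower_semicontinuous f \<longleftrightarrow> (\<forall>x. f x \<le> Liminf (at x) f)"

definition dir_nbhd_basic :: "real \<Rightarrow> real \<Rightarrow> 'a::real_normed_vector \<Rightarrow> 'a set" where
  "dir_nbhd_basic \<rho> \<delta> u =
     {z \<in> cball 0 \<rho>. norm (norm u *\<^sub>R z - norm z *\<^sub>R u) \<le> \<delta> * norm z * norm u}"

definition directional_nbhd :: "'a::real_normed_vector \<Rightarrow> 'a set \<Rightarrow> bool" where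
  "directional_nbhd u U \<longleftrightarrow> (\<exists>\<rho>>0. \<exists>\<delta>>0. dir_nbhd_basic \<rho> \<delta> u \<subseteq> U)"

text \<open>Unlike \<^const>\<open>infdist\<close>, the distance to the empty set is \<open>\<infinity>\<close>.\<close>

definition edist_set :: "'a::metric_space \<Rightarrow> 'a set \<Rightarrow> ereal" where
  "edist_set x A = (INF a\<in>A. ereal (dist x a))"

definition metrically_subregular_dir ::
    "('a::real_normed_vector \<Rightarrow> 'b::metric_space set) \<Rightarrow> 'a \<Rightarrow> 'b \<Rightarrow> 'a \<Rightarrow> bool" where
  "metrically_subregular_dir F z\<^sub>0 w\<^sub>0 u \<longleftrightarrow>
     w\<^sub>0 \<in> F z\<^sub>0 \<and>
     (\<exists>\<kappa>>0. \<exists>U. directional_nbhd u U \<and>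
        (\<forall>z \<in> (+) z\<^sub>0 ` U. edist_set z {z'. w\<^sub>0 \<in> F z'} \<le> ereal \<kappa> * edist_set w\<^sub>0 (F z)))"

end

theory Submission
  imports Defs
begin

text \<open>The epigraph \<open>C\<close> of \<open>f (\<cdot>, ybar)\<close> is the slice of the closed set \<open>E = epi f\<close> at height \<open>ybar\<close>,
  and subregularity of \<open>F\<close> says that, in the given direction, the distance of \<open>z\<close> to \<open>C\<close> is at most
  \<open>\<kappa>\<close> times the distance of \<open>(z, ybar)\<close> to \<open>E\<close>. So the claim is a lifting property of normals: a
  directional limiting normal \<open>\<xi>\<close> of the slice extends, by some component \<open>y'\<close> in the \<open>y\<close>-space, to a
  directional limiting normal of \<open>E\<close> (\<open>limiting_normal_slice\<close>).

  Let \<open>\<xi>\<close> be a regular normal of \<open>C\<close> at \<open>z0\<close>, and let \<open>(z, y)\<close> be a point of \<open>E\<close> near \<open>(z0, ybar)\<close>.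
  Projecting \<open>z\<close> onto \<open>C\<close> costs at most \<open>\<kappa> \<parallel>y - ybar\<parallel>\<close>, whence
  \<open>\<xi> \<bullet> (z - z0) \<le> \<kappa> \<parallel>\<xi>\<parallel> \<parallel>y - ybar\<parallel> + o\<close>, where \<open>o\<close> is of smaller order than the distance of
  \<open>(z, y)\<close> from \<open>(z0, ybar)\<close>
  (\<open>slice_normal_imp_penalised_inequality\<close>). This exact penalisation makes \<open>(z0, ybar)\<close> an approximate
  minimiser over \<open>E\<close> of a linear function plus a multiple of \<open>\<parallel>y - ybar\<parallel>\<close>. After smoothing the norms,
  a true minimiser exists arbitrarily close to \<open>(z0, ybar)\<close>, and the negative gradient there is a
  regular normal of \<open>E\<close> that is nearly \<open>(\<xi>, v)\<close> with \<open>\<parallel>v\<parallel> \<le> \<kappa> \<parallel>\<xi>\<parallel>\<close>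
  (\<open>penalised_inequality_imp_nearby_normal\<close>).

  For a directional limiting normal this is done at every point \<open>z0 + t k u' k\<close> of the defining
  sequence, with error \<open>o (t k)\<close> in the base point, so that the limit direction is unaffected and has
  \<open>y\<close>-component \<open>0\<close>. The components \<open>v k\<close> are bounded, so a subsequence converges to the required
  \<open>y'\<close>.\<close>

section \<open>Regular normals\<close>

text \<open>The inequality is stated without division, so that it may include \<open>x' = x\<close> and so that the trivial
  filter at an isolated point needs no separate treatment.\<close>

lemma regular_normal_cone_iff:
  "\<xi> \<in> regular_normal_cone \<Omega> x \<longleftrightarrow>
     x \<in> \<Omega> \<and> (\<forall>\<epsilon>>0. \<exists>r>0. \<forall>x'\<in>\<Omega>. dist x' x < r \<longrightarrow> \<xi> \<bullet> (x' - x) \<le> \<epsilon> * norm (x' - x))"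
    (is "_ \<longleftrightarrow> x \<in> \<Omega> \<and> ?R")
proof (cases "x \<in> \<Omega>")
  case True
  let ?q = "\<lambda>x'. (\<xi> \<bullet> (x' - x)) / norm (x' - x)"
  have "\<xi> \<in> regular_normal_cone \<Omega> x \<longleftrightarrow>
      (\<forall>y>0. \<forall>\<^sub>F x' in at x within \<Omega>. ereal (?q x') < y)"
    using True by (simp add: regular_normal_cone_def Limsup_le_iff)
  also have "\<dots> \<longleftrightarrow> (\<forall>\<epsilon>>0. \<forall>\<^sub>F x' in at x within \<Omega>. ?q x' < \<epsilon>)"
  proof safe
    fix \<epsilon> :: real assume "\<forall>y>0. \<forall>\<^sub>F x' in at x within \<Omega>. ereal (?q x') < y" "\<epsilon> > 0"
    from this(1)[rule_format, of "ereal \<epsilon>"] this(2)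
    show "\<forall>\<^sub>F x' in at x within \<Omega>. ?q x' < \<epsilon>" by simp
  next
    fix y :: ereal assume *: "\<forall>\<epsilon>>0. \<forall>\<^sub>F x' in at x within \<Omega>. ?q x' < \<epsilon>" and "0 < y"
    then show "\<forall>\<^sub>F x' in at x within \<Omega>. ereal (?q x') < y"
      by (cases y) auto
  qed
  also have "\<dots> \<longleftrightarrow> ?R"
  proof safe
    fix \<epsilon> :: real assume "\<forall>\<epsilon>>0. \<forall>\<^sub>F x' in at x within \<Omega>. ?q x' < \<epsilon>" "\<epsilon> > 0"
    then obtain r where r: "r > 0" "\<And>x'. x' \<in> \<Omega> \<Longrightarrow> x' \<noteq> x \<Longrightarrow> dist x' x < r \<Longrightarrow> ?q x' < \<epsilon>"
      unfolding eventually_at by metis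
    have "\<xi> \<bullet> (x' - x) \<le> \<epsilon> * norm (x' - x)" if "x' \<in> \<Omega>" "dist x' x < r" for x'
      using r(2)[of x'] that by (cases "x' = x") (auto simp: divide_less_eq)
    with r(1) show "\<exists>r>0. \<forall>x'\<in>\<Omega>. dist x' x < r \<longrightarrow> \<xi> \<bullet> (x' - x) \<le> \<epsilon> * norm (x' - x)"
      by blast
  next
    fix \<epsilon> :: real assume R: ?R and "\<epsilon> > 0"
    then have "\<epsilon> / 2 > 0" by simp
    with R obtain r where r: "r > 0"
      "\<And>x'. x' \<in> \<Omega> \<Longrightarrow> dist x' x < r \<Longrightarrow> \<xi> \<bullet> (x' - x) \<le> \<epsilon> / 2 * norm (x' - x)"
      by blast
    have "?q x' < \<epsilon>" if "x' \<in> \<Omega>" "x' \<noteq> x" "dist x' x < r" for x'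
    proof -
      have "?q x' \<le> \<epsilon> / 2"
        using r(2)[OF that(1,3)] that(2) by (simp add: divide_le_eq)
      also have "\<epsilon> / 2 < \<epsilon>" using \<open>\<epsilon> > 0\<close> by simp
      finally show ?thesis .
    qed
    with r(1) show "\<forall>\<^sub>F x' in at x within \<Omega>. ?q x' < \<epsilon>"
      unfolding eventually_at by blast
  qed
  finally show ?thesis using True by simp
qed (simp add: regular_normal_cone_def)

text \<open>A quadratic error is of smaller order than the linear one allowed for regular normals. This is
  how regular normals are produced below: the functions that are minimised have a quadratic
  upper bound, which makes their derivatives dispensable.\<close>

lemma proximal_normal_imp_regular:
  assumes "x \<in> \<Omega>" and "r > 0"
    and prox: "\<And>x'. x' \<in> \<Omega> \<Longrightarrow> dist x' x < r \<Longrightarrow> \<xi> \<bullet> (x' - x) \<le> K * (norm (x' - x))\<^sup>2"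
  shows "\<xi> \<in> regular_normal_cone \<Omega> x"
  unfolding regular_normal_cone_iff
proof (intro conjI allI impI)
  fix \<epsilon> :: real assume "\<epsilon> > 0"
  define s where "s = min r (\<epsilon> / (\<bar>K\<bar> + 1))"
  have "s > 0" using \<open>r > 0\<close> \<open>\<epsilon> > 0\<close> by (auto simp: s_def)
  moreover have "\<xi> \<bullet> (x' - x) \<le> \<epsilon> * norm (x' - x)" if "x' \<in> \<Omega>" "dist x' x < s" for x'
  proof -
    have n: "norm (x' - x) \<le> \<epsilon> / (\<bar>K\<bar> + 1)"
      using that(2) by (simp add: s_def dist_norm)
    have "K * norm (x' - x) \<le> (\<bar>K\<bar> + 1) * norm (x' - x)"
      by (intro mult_right_mono) auto
    also have "\<dots> \<le> \<epsilon>"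
      using n by (simp add: pos_le_divide_eq mult.commute)
    finally have "K * norm (x' - x) * norm (x' - x) \<le> \<epsilon> * norm (x' - x)"
      by (intro mult_right_mono) auto
    with prox[OF that(1)] that(2) show ?thesis
      by (simp add: s_def power2_eq_square mult.assoc)
  qed
  ultimately show "\<exists>s>0. \<forall>x'\<in>\<Omega>. dist x' x < s \<longrightarrow> \<xi> \<bullet> (x' - x) \<le> \<epsilon> * norm (x' - x)"
    by blast
qed (rule assms(1))

section \<open>A smooth majorant of the norm\<close>

text \<open>For \<open>\<eta> > 0\<close> this function has, unlike the norm itself, at every point a tangent that bounds it
  from above up to a quadratic term, even at \<open>0\<close>; it exceeds the norm by at most \<open>\<eta>\<close>.\<close>

definition smooth_norm :: "real \<Rightarrow> 'a::real_inner \<Rightarrow> real" where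
  "smooth_norm \<eta> v = sqrt ((norm v)\<^sup>2 + \<eta>\<^sup>2)"

lemma norm_le_smooth_norm: "norm v \<le> smooth_norm \<eta> v"
  unfolding smooth_norm_def by (rule real_le_rsqrt) simp

lemma le_smooth_norm: "\<eta> \<le> smooth_norm \<eta> v"
  unfolding smooth_norm_def by (rule real_le_rsqrt) simp

lemma smooth_norm_zero: "\<eta> \<ge> 0 \<Longrightarrow> smooth_norm \<eta> 0 = \<eta>"
  by (simp add: smooth_norm_def)

lemma continuous_on_smooth_norm [continuous_intros]:
  "continuous_on S g \<Longrightarrow> continuous_on S (\<lambda>x. smooth_norm \<eta> (g x))"
  unfolding smooth_norm_def by (intro continuous_intros)

definition smooth_norm_grad :: "real \<Rightarrow> 'a::real_inner \<Rightarrow> 'a" where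
  "smooth_norm_grad \<eta> v = v /\<^sub>R smooth_norm \<eta> v"

lemma norm_smooth_norm_grad: "norm (smooth_norm_grad \<eta> v) \<le> 1"
proof -
  have "smooth_norm \<eta> v \<ge> 0" by (simp add: smooth_norm_def)
  then show ?thesis
    using norm_le_smooth_norm[of v \<eta>]
    by (cases "smooth_norm \<eta> v = 0") (simp_all add: smooth_norm_grad_def field_simps)
qed

text \<open>The square root is concave, so \<open>b - a \<le> (b\<^sup>2 - a\<^sup>2) / (2 a)\<close> for \<open>a > 0\<close>, and \<open>b\<^sup>2 - a\<^sup>2\<close> is
  an exact quadratic polynomial in the increment.\<close>

lemma smooth_norm_upper_quadratic:
  assumes "\<eta> > 0"
  shows "smooth_norm \<eta> w \<le> smooth_norm \<eta> v + smooth_norm_grad \<eta> v \<bullet> (w - v)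
           + (norm (w - v))\<^sup>2 / (2 * \<eta>)"
proof -
  define a b where "a = smooth_norm \<eta> v" and "b = smooth_norm \<eta> w"
  have a: "a \<ge> \<eta>" "a > 0"
    using le_smooth_norm[of \<eta> v] assms by (auto simp: a_def)
  have sq: "b\<^sup>2 - a\<^sup>2 = 2 * (v \<bullet> (w - v)) + (norm (w - v))\<^sup>2"
    by (simp add: a_def b_def smooth_norm_def power2_norm_eq_inner inner_diff inner_commute)
  have "0 \<le> (b - a)\<^sup>2" by simp
  then have "2 * a * (b - a) \<le> b\<^sup>2 - a\<^sup>2"
    by (simp add: power2_eq_square algebra_simps)
  then have "b - a \<le> (b\<^sup>2 - a\<^sup>2) / (2 * a)"
    using a by (simp add: field_simps)
  moreover have "(b\<^sup>2 - a\<^sup>2) / (2 * a) = (v /\<^sub>R a) \<bullet> (w - v) + (norm (w - v))\<^sup>2 / (2 * a)"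
    unfolding sq using a by (simp add: field_simps)
  moreover have "(norm (w - v))\<^sup>2 / (2 * a) \<le> (norm (w - v))\<^sup>2 / (2 * \<eta>)"
    using a assms by (intro divide_left_mono) auto
  ultimately have "b \<le> a + (v /\<^sub>R a) \<bullet> (w - v) + (norm (w - v))\<^sup>2 / (2 * \<eta>)"
    by linarith
  then show ?thesis
    by (simp only: a_def b_def smooth_norm_grad_def)
qed

section \<open>Fuzzy normals from a penalised inequality\<close>

text \<open>The hypothesis says that \<open>w0\<close> minimises
  \<open>- \<zeta> \<bullet> (w - w0) + L \<parallel>Q (w - w0)\<parallel> + \<epsilon> \<parallel>w - w0\<parallel>\<close> over \<open>E\<close> near \<open>w0\<close>. The norms are not
  differentiable at \<open>w0\<close>, so they are smoothed; the smoothed function has a minimiser \<open>w\<close> on the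
  compact set \<open>cball w0 r \<inter> E\<close>, in general different from \<open>w0\<close>. Raising the coefficient \<open>\<epsilon>\<close> to \<open>2 \<epsilon>\<close>
  keeps \<open>w\<close> off the boundary of the ball, and first-order optimality then gives the normal.\<close>

lemma penalised_inequality_imp_nearby_normal:
  fixes E :: "'w::euclidean_space set" and Q :: "'w \<Rightarrow> 'b::euclidean_space"
  assumes "closed E" "w0 \<in> E" "linear Q" "L \<ge> 0" "\<epsilon> > 0" "r > 0"
    and ineq: "\<And>w. w \<in> E \<Longrightarrow> dist w w0 \<le> r \<Longrightarrow>
                 \<zeta> \<bullet> (w - w0) \<le> L * norm (Q (w - w0)) + \<epsilon> * norm (w - w0)"
  obtains w v \<zeta>' where "dist w w0 < r" "norm v \<le> L"
    "\<zeta>' \<in> regular_normal_cone E w" "norm (\<zeta>' - (\<zeta> - adjoint Q v)) \<le> 2 * \<epsilon>"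
proof -
  \<comment> \<open>At \<open>w0\<close> the smoothing costs \<open>(L + 2 \<epsilon>) \<eta>\<close>, which must stay below the gain \<open>\<epsilon> r\<close> on the sphere.\<close>
  define \<eta> where "\<eta> = \<epsilon> * r / (2 * (L + 2 * \<epsilon>))"
  have pos: "L + 2 * \<epsilon> > 0" using assms by simp
  have \<eta>: "\<eta> > 0" using assms pos by (simp add: \<eta>_def)
  have \<eta>_small: "L * \<eta> + 2 * \<epsilon> * \<eta> < \<epsilon> * r"
  proof -
    have "c * (\<epsilon> * r / (2 * c)) = \<epsilon> * r / 2" if "c > 0" for c :: real
      using that by simp
    from this[OF pos] have "L * \<eta> + 2 * \<epsilon> * \<eta> = \<epsilon> * r / 2"
      unfolding \<eta>_def distrib_right .
    also have "\<dots> < \<epsilon> * r" using assms by simp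
    finally show ?thesis .
  qed
  define G where "G w = - (\<zeta> \<bullet> (w - w0)) + L * smooth_norm \<eta> (Q (w - w0))
                    + 2 * \<epsilon> * smooth_norm \<eta> (w - w0)" for w
  have contQ: "continuous_on S (\<lambda>w. Q (w - w0))" for S
    by (rule continuous_on_compose2[OF linear_continuous_on])
       (auto intro!: continuous_intros linear_conv_bounded_linear[THEN iffD1] \<open>linear Q\<close>)
  have "continuous_on (cball w0 r \<inter> E) G"
    unfolding G_def by (intro continuous_intros contQ)
  moreover have "compact (cball w0 r \<inter> E)"
    using \<open>closed E\<close> by (intro compact_Int_closed) auto
  moreover have "w0 \<in> cball w0 r \<inter> E" using assms by simp
  ultimately obtain w where w: "w \<in> cball w0 r \<inter> E"
    and min: "\<And>w'. w' \<in> cball w0 r \<inter> E \<Longrightarrow> G w \<le> G w'"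
    using continuous_attains_inf[of "cball w0 r \<inter> E" G] by blast
  have wE: "w \<in> E" and wr: "dist w w0 \<le> r" using w by (auto simp: dist_commute)
  have "\<epsilon> * norm (w - w0) \<le> G w"
  proof -
    have "L * norm (Q (w - w0)) \<le> L * smooth_norm \<eta> (Q (w - w0))"
      using \<open>L \<ge> 0\<close> norm_le_smooth_norm by (intro mult_left_mono)
    moreover have "2 * \<epsilon> * norm (w - w0) \<le> 2 * \<epsilon> * smooth_norm \<eta> (w - w0)"
      using \<open>\<epsilon> > 0\<close> norm_le_smooth_norm by (intro mult_left_mono) auto
    ultimately show ?thesis using ineq[OF wE wr] by (simp add: G_def)
  qed
  also have "G w \<le> G w0" using min[of w0] assms by simp
  also have "G w0 = L * \<eta> + 2 * \<epsilon> * \<eta>"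
    using \<eta> by (simp add: G_def smooth_norm_zero linear_0[OF \<open>linear Q\<close>])
  also note \<eta>_small
  finally have wr': "dist w w0 < r" using \<open>\<epsilon> > 0\<close> by (simp add: dist_norm)
  \<comment> \<open>\<open>\<zeta>'\<close> is the negative gradient of \<open>G\<close> at \<open>w\<close>.\<close>
  define g where "g = smooth_norm_grad \<eta> (Q (w - w0))"
  define e where "e = smooth_norm_grad \<eta> (w - w0)"
  define \<zeta>' where "\<zeta>' = \<zeta> - adjoint Q (L *\<^sub>R g) - (2 * \<epsilon>) *\<^sub>R e"
  obtain B where B: "\<And>x. norm (Q x) \<le> norm x * B"
    using bounded_linear.bounded[of Q] \<open>linear Q\<close> linear_conv_bounded_linear by blast
  have "\<zeta>' \<in> regular_normal_cone E w"
  proof (rule proximal_normal_imp_regular[OF wE])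
    show "r - dist w w0 > 0" using wr' by simp
    fix w' assume w': "w' \<in> E" "dist w' w < r - dist w w0"
    have "w' \<in> cball w0 r \<inter> E"
      using w' dist_triangle[of w' w0 w] by (simp add: dist_commute)
    from min[OF this] have "\<zeta> \<bullet> (w' - w)
        \<le> L * (smooth_norm \<eta> (Q (w' - w0)) - smooth_norm \<eta> (Q (w - w0)))
          + 2 * \<epsilon> * (smooth_norm \<eta> (w' - w0) - smooth_norm \<eta> (w - w0))"
      by (simp add: G_def algebra_simps inner_diff)
    also have "\<dots> \<le> L * (g \<bullet> Q (w' - w) + (norm (Q (w' - w)))\<^sup>2 / (2 * \<eta>))
          + 2 * \<epsilon> * (e \<bullet> (w' - w) + (norm (w' - w))\<^sup>2 / (2 * \<eta>))"
    proof (intro add_mono mult_left_mono)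
      have "Q (w' - w0) - Q (w - w0) = Q (w' - w)"
        using linear_diff[OF \<open>linear Q\<close>] by simp
      then show "smooth_norm \<eta> (Q (w' - w0)) - smooth_norm \<eta> (Q (w - w0))
          \<le> g \<bullet> Q (w' - w) + (norm (Q (w' - w)))\<^sup>2 / (2 * \<eta>)"
        using smooth_norm_upper_quadratic[OF \<eta>, of "Q (w' - w0)" "Q (w - w0)"]
        by (simp add: g_def)
      show "smooth_norm \<eta> (w' - w0) - smooth_norm \<eta> (w - w0)
          \<le> e \<bullet> (w' - w) + (norm (w' - w))\<^sup>2 / (2 * \<eta>)"
        using smooth_norm_upper_quadratic[OF \<eta>, of "w' - w0" "w - w0"]
        by (simp add: e_def)
    qed (use assms in auto)
    also have "\<dots> \<le> L * (g \<bullet> Q (w' - w) + (norm (w' - w) * B)\<^sup>2 / (2 * \<eta>))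
          + 2 * \<epsilon> * (e \<bullet> (w' - w) + (norm (w' - w))\<^sup>2 / (2 * \<eta>))"
      using B[of "w' - w"] \<eta> \<open>L \<ge> 0\<close> \<open>\<epsilon> > 0\<close>
      by (intro add_mono mult_left_mono divide_right_mono power_mono) auto
    finally have "\<zeta> \<bullet> (w' - w) - L * (g \<bullet> Q (w' - w)) - 2 * \<epsilon> * (e \<bullet> (w' - w))
        \<le> (L * B\<^sup>2 / (2 * \<eta>) + \<epsilon> / \<eta>) * (norm (w' - w))\<^sup>2"
      using \<eta> by (simp add: algebra_simps power_mult_distrib)
    moreover have "adjoint Q (L *\<^sub>R g) \<bullet> (w' - w) = L * (g \<bullet> Q (w' - w))"
      using adjoint_works[OF \<open>linear Q\<close>, of "w' - w" "L *\<^sub>R g"] by (simp add: inner_commute)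
    ultimately show "\<zeta>' \<bullet> (w' - w) \<le> (L * B\<^sup>2 / (2 * \<eta>) + \<epsilon> / \<eta>) * (norm (w' - w))\<^sup>2"
      by (simp add: \<zeta>'_def inner_diff_left)
  qed
  moreover have "norm (L *\<^sub>R g) \<le> L"
    using norm_smooth_norm_grad[of \<eta> "Q (w - w0)"] \<open>L \<ge> 0\<close>
    by (simp add: g_def mult_left_le)
  moreover have "norm (\<zeta>' - (\<zeta> - adjoint Q (L *\<^sub>R g))) \<le> 2 * \<epsilon>"
    using norm_smooth_norm_grad[of \<eta> "w - w0"] \<open>\<epsilon> > 0\<close>
    by (simp add: \<zeta>'_def e_def)
  ultimately show thesis using that wr' by blast
qed

section \<open>Normals to a slice\<close>

text \<open>A point \<open>(x, \<alpha>)\<close> of the slice space is completed by its missing middle coordinate \<open>y\<close> to the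
  point \<open>((x, y), \<alpha>)\<close>, which is the shape of the points of an epigraph. Up to this reordering it is
  the pair of \<open>z\<close> and \<open>y\<close>.\<close>

definition insert_mid :: "'a \<times> 'c \<Rightarrow> 'b \<Rightarrow> ('a \<times> 'b) \<times> 'c" where
  "insert_mid z y = ((fst z, y), snd z)"

lemma insert_mid_diff: "insert_mid z y - insert_mid z' y' = insert_mid (z - z') (y - y')"
  by (simp add: insert_mid_def)

lemma insert_mid_add: "insert_mid z y + insert_mid z' y' = insert_mid (z + z') (y + y')"
  by (simp add: insert_mid_def)

lemma insert_mid_scaleR: "c *\<^sub>R insert_mid z y = insert_mid (c *\<^sub>R z) (c *\<^sub>R y)"
  by (simp add: insert_mid_def)

lemma inner_insert_mid: "insert_mid z y \<bullet> insert_mid z' y' = z \<bullet> z' + y \<bullet> y'"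
  by (simp add: insert_mid_def inner_prod_def)

lemma tendsto_insert_mid [tendsto_intros]:
  "(g \<longlongrightarrow> z) F \<Longrightarrow> (h \<longlongrightarrow> y) F \<Longrightarrow> ((\<lambda>k. insert_mid (g k) (h k)) \<longlongrightarrow> insert_mid z y) F"
  unfolding insert_mid_def by (intro tendsto_intros)

lemma continuous_on_insert_mid: "continuous_on S (\<lambda>z. insert_mid z y)"
  unfolding insert_mid_def by (intro continuous_intros)

lemma norm_le_norm_insert_mid:
  fixes z :: "'a::real_inner \<times> 'c::real_inner" and y :: "'b::real_inner"
  shows "norm z \<le> norm (insert_mid z y)"
  unfolding norm_eq_sqrt_inner inner_insert_mid by simp

lemma adjoint_middle:
  "adjoint (\<lambda>w :: ('a::euclidean_space \<times> 'b::euclidean_space) \<times> 'c::euclidean_space. snd (fst w))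
     = insert_mid 0"
  by (rule adjoint_unique) (auto simp: insert_mid_def inner_prod_def)

text \<open>Exact penalisation. For \<open>(z, y)\<close> in \<open>E\<close> let \<open>c\<close> be a projection of \<open>z\<close> onto the slice. The part
  \<open>\<xi> \<bullet> (z - c)\<close> is controlled by the error bound \<open>err\<close>; the part \<open>\<xi> \<bullet> (c - z0)\<close> is small because \<open>\<xi>\<close>
  is normal to the slice and \<open>c\<close> is at most twice as far from \<open>z0\<close> as \<open>z\<close> is. The factor two is the
  reason for the halves in the proof.\<close>

lemma slice_normal_imp_penalised_inequality:
  fixes E :: "(('a::euclidean_space \<times> 'b::euclidean_space) \<times> 'c::euclidean_space) set"
  assumes "closed E" and normal: "\<xi> \<in> regular_normal_cone {z. insert_mid z ybar \<in> E} z0"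
    and "r0 > 0" "\<epsilon> > 0" "\<kappa> \<ge> 0"
    and err: "\<And>z y. dist z z0 < r0 \<Longrightarrow> insert_mid z y \<in> E \<Longrightarrow>
                infdist z {z. insert_mid z ybar \<in> E} \<le> \<kappa> * norm (y - ybar)"
  obtains r where "r > 0"
    "\<And>w. w \<in> E \<Longrightarrow> dist w (insert_mid z0 ybar) < r \<Longrightarrow>
       insert_mid \<xi> 0 \<bullet> (w - insert_mid z0 ybar)
         \<le> \<kappa> * norm \<xi> * norm (snd (fst (w - insert_mid z0 ybar))) + \<epsilon> * norm (w - insert_mid z0 ybar)"
proof -
  let ?C = "{z. insert_mid z ybar \<in> E}"
  have "\<epsilon> / 2 > 0" using assms by simp
  with normal obtain s where z0: "z0 \<in> ?C" and "s > 0"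
    and s: "\<And>z. z \<in> ?C \<Longrightarrow> dist z z0 < s \<Longrightarrow> \<xi> \<bullet> (z - z0) \<le> \<epsilon> / 2 * norm (z - z0)"
    unfolding regular_normal_cone_iff by meson
  have "?C = (\<lambda>z. insert_mid z ybar) -` E" by auto
  then have "closed ?C"
    using closed_vimage[OF \<open>closed E\<close> continuous_on_insert_mid] by simp
  define r where "r = min r0 (s / 2)"
  have "r > 0" using \<open>s > 0\<close> assms by (simp add: r_def)
  moreover have "insert_mid \<xi> 0 \<bullet> (w - insert_mid z0 ybar)
         \<le> \<kappa> * norm \<xi> * norm (snd (fst (w - insert_mid z0 ybar))) + \<epsilon> * norm (w - insert_mid z0 ybar)"
    if w: "w \<in> E" "dist w (insert_mid z0 ybar) < r" for w
  proof -
    define z y where "z = (fst (fst w), snd w)" and "y = snd (fst w)"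
    have w_eq: "w = insert_mid z y" by (simp add: insert_mid_def z_def y_def)
    have diff: "w - insert_mid z0 ybar = insert_mid (z - z0) (y - ybar)"
      by (simp add: w_eq insert_mid_diff)
    have le: "norm (z - z0) \<le> norm (w - insert_mid z0 ybar)"
      by (simp add: diff norm_le_norm_insert_mid)
    have zr: "dist z z0 < r" using le w(2) by (simp add: dist_norm)
    obtain c where c: "c \<in> ?C" "infdist z ?C = dist z c"
      using infdist_attains_inf[OF \<open>closed ?C\<close>] z0 by blast
    have zc: "dist z c \<le> \<kappa> * norm (y - ybar)"
      using err[of z y] c w(1) zr by (simp add: w_eq r_def)
    have "dist z c \<le> dist z z0" using infdist_le[OF z0, of z] c by simp
    then have cz0: "dist c z0 \<le> 2 * dist z z0"
      using dist_triangle3[of c z0 z] by simp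
    then have "dist c z0 < s" using zr by (simp add: r_def)
    have "insert_mid \<xi> 0 \<bullet> (w - insert_mid z0 ybar) = \<xi> \<bullet> (z - c) + \<xi> \<bullet> (c - z0)"
      by (simp add: diff inner_insert_mid inner_diff_right)
    also have "\<xi> \<bullet> (z - c) \<le> norm \<xi> * dist z c"
      using norm_cauchy_schwarz by (simp add: dist_norm)
    also have "\<dots> \<le> norm \<xi> * (\<kappa> * norm (y - ybar))"
      using zc by (intro mult_left_mono) auto
    also have "\<xi> \<bullet> (c - z0) \<le> \<epsilon> / 2 * dist c z0"
      using s[OF c(1) \<open>dist c z0 < s\<close>] by (simp add: dist_norm)
    also have "\<dots> \<le> \<epsilon> * norm (w - insert_mid z0 ybar)"
    proof -
      have "dist c z0 \<le> 2 * norm (w - insert_mid z0 ybar)" using cz0 le by (simp add: dist_norm)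
      then have "\<epsilon> / 2 * dist c z0 \<le> \<epsilon> / 2 * (2 * norm (w - insert_mid z0 ybar))"
        using \<open>\<epsilon> > 0\<close> by (intro mult_left_mono) auto
      then show ?thesis by simp
    qed
    finally show ?thesis
      unfolding diff by (simp add: insert_mid_def mult_ac)
  qed
  ultimately show thesis using that by blast
qed

lemma slice_normal_imp_nearby_normal:
  fixes E :: "(('a::euclidean_space \<times> 'b::euclidean_space) \<times> 'c::euclidean_space) set"
  assumes "closed E" and normal: "\<xi> \<in> regular_normal_cone {z. insert_mid z ybar \<in> E} z0"
    and "r0 > 0" "\<epsilon> > 0" "\<kappa> \<ge> 0"
    and err: "\<And>z y. dist z z0 < r0 \<Longrightarrow> insert_mid z y \<in> E \<Longrightarrow>
                infdist z {z. insert_mid z ybar \<in> E} \<le> \<kappa> * norm (y - ybar)"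
    and "s > 0"
  obtains w v \<zeta>' where "dist w (insert_mid z0 ybar) < s" "norm v \<le> \<kappa> * norm \<xi>"
    "\<zeta>' \<in> regular_normal_cone E w" "norm (\<zeta>' - insert_mid \<xi> v) \<le> 2 * \<epsilon>"
proof -
  obtain r where "r > 0" and r: "\<And>w. w \<in> E \<Longrightarrow> dist w (insert_mid z0 ybar) < r \<Longrightarrow>
       insert_mid \<xi> 0 \<bullet> (w - insert_mid z0 ybar)
         \<le> \<kappa> * norm \<xi> * norm (snd (fst (w - insert_mid z0 ybar))) + \<epsilon> * norm (w - insert_mid z0 ybar)"
    using slice_normal_imp_penalised_inequality[OF assms(1-6)] by blast
  have w0: "insert_mid z0 ybar \<in> E" using normal by (simp add: regular_normal_cone_iff)
  have lin: "linear (\<lambda>w :: ('a \<times> 'b) \<times> 'c. snd (fst w))"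
    by (rule linearI) auto
  have m: "min (r / 2) s > 0" using \<open>r > 0\<close> \<open>s > 0\<close> by simp
  have L: "\<kappa> * norm \<xi> \<ge> 0" using \<open>\<kappa> \<ge> 0\<close> by simp
  have ineq: "insert_mid \<xi> 0 \<bullet> (w - insert_mid z0 ybar)
      \<le> \<kappa> * norm \<xi> * norm (snd (fst (w - insert_mid z0 ybar))) + \<epsilon> * norm (w - insert_mid z0 ybar)"
    if "w \<in> E" "dist w (insert_mid z0 ybar) \<le> min (r / 2) s" for w
    using r[OF that(1)] that(2) \<open>r > 0\<close> by simp
  show thesis
  proof (rule penalised_inequality_imp_nearby_normal[OF \<open>closed E\<close> w0 lin L \<open>\<epsilon> > 0\<close> m ineq])
    fix w v \<zeta>'
    assume "dist w (insert_mid z0 ybar) < min (r / 2) s" "norm v \<le> \<kappa> * norm \<xi>"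
      "\<zeta>' \<in> regular_normal_cone E w"
      "norm (\<zeta>' - (insert_mid \<xi> 0 - adjoint (\<lambda>w. snd (fst w)) v)) \<le> 2 * \<epsilon>"
    then show thesis
      using that[of w "- v" \<zeta>'] by (simp add: adjoint_middle insert_mid_diff)
  qed
qed

section \<open>Directional neighbourhoods and limiting normals\<close>

text \<open>Scaling by \<open>t > 0\<close> does not affect the angular condition, so it suffices that \<open>v\<close> be close to \<open>u\<close>;
  \<open>t\<close> is restricted only by the radius. Consequently the neighbourhood contains a ball around \<open>t u'\<close>
  of radius proportional to \<open>t\<close>, for \<open>u'\<close> near \<open>u\<close>, which gives the error bound on a full neighbourhood of
  each point of a sequence that approaches in direction \<open>u\<close>.\<close>

lemma dir_nbhd_basic_contains_truncated_cone:
  fixes u :: "'a::real_normed_vector"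
  assumes "\<rho> > 0" "\<delta> > 0"
  shows "\<exists>\<sigma>>0. \<exists>\<tau>>0. \<forall>t v. 0 < t \<longrightarrow> t < \<tau> \<longrightarrow> dist v u < \<sigma> \<longrightarrow>
           t *\<^sub>R v \<in> dir_nbhd_basic \<rho> \<delta> u"
proof -
  \<comment> \<open>For \<open>u \<noteq> 0\<close>, \<open>\<sigma> \<le> \<parallel>u\<parallel> / 2\<close> forces \<open>\<parallel>v\<parallel> \<ge> \<parallel>u\<parallel> / 2\<close>, and then the angular defect, at most
    \<open>2 \<sigma> \<parallel>u\<parallel>\<close>, is below \<open>\<delta> \<parallel>v\<parallel> \<parallel>u\<parallel>\<close>. For \<open>u = 0\<close> the angular condition is void.\<close>
  define \<sigma> where "\<sigma> = (if u = 0 then 1 else min (norm u / 2) (\<delta> * norm u / 4))"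
  define \<tau> where "\<tau> = \<rho> / (norm u + \<sigma>)"
  have \<sigma>: "\<sigma> > 0" using assms by (auto simp: \<sigma>_def)
  have \<tau>: "\<tau> > 0" using assms \<sigma> by (simp add: \<tau>_def add_nonneg_pos)
  have "t *\<^sub>R v \<in> dir_nbhd_basic \<rho> \<delta> u" if t: "0 < t" "t < \<tau>" and v: "dist v u < \<sigma>" for t v
  proof -
    have vu: "norm (v - u) < \<sigma>" using v by (simp add: dist_norm)
    have "norm v \<le> norm u + \<sigma>" using norm_triangle_sub[of v u] vu by simp
    then have "t * norm v \<le> \<tau> * (norm u + \<sigma>)" using t by (intro mult_mono) auto
    also have "\<dots> = \<rho>" using \<sigma> by (simp add: \<tau>_def add_nonneg_eq_0_iff)
    finally have ball: "t *\<^sub>R v \<in> cball 0 \<rho>" using t by simp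
    have "norm (norm u *\<^sub>R v - norm v *\<^sub>R u) \<le> \<delta> * norm v * norm u"
    proof (cases "u = 0")
      case False
      have "norm u *\<^sub>R v - norm v *\<^sub>R u = norm u *\<^sub>R (v - u) + (norm u - norm v) *\<^sub>R u"
        by (simp add: algebra_simps)
      also have "norm \<dots> \<le> norm u * norm (v - u) + \<bar>norm u - norm v\<bar> * norm u"
        by (metis norm_triangle_ineq norm_scaleR abs_norm_cancel)
      also have "\<bar>norm u - norm v\<bar> \<le> norm (v - u)"
        by (metis norm_triangle_ineq3 norm_minus_commute)
      finally have "norm (norm u *\<^sub>R v - norm v *\<^sub>R u) \<le> (2 * norm (v - u)) * norm u"
        by (simp add: mult_right_mono algebra_simps)
      also have "2 * norm (v - u) \<le> \<delta> * norm v"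
      proof -
        have "norm v \<ge> norm u / 2"
          using norm_triangle_sub[of u v] vu False by (simp add: \<sigma>_def norm_minus_commute)
        then have "\<delta> * norm v \<ge> \<delta> * (norm u / 2)" using \<open>\<delta> > 0\<close> by (intro mult_left_mono) auto
        then show ?thesis using vu False by (simp add: \<sigma>_def)
      qed
      finally show ?thesis by (simp add: mult_right_mono)
    qed simp
    then have "t * norm (norm u *\<^sub>R v - norm v *\<^sub>R u) \<le> t * (\<delta> * norm v * norm u)"
      using t by (intro mult_left_mono) auto
    moreover have "norm u *\<^sub>R t *\<^sub>R v - norm (t *\<^sub>R v) *\<^sub>R u = t *\<^sub>R (norm u *\<^sub>R v - norm v *\<^sub>R u)"
      using t by (simp add: scaleR_diff_right mult.commute)
    ultimately show ?thesis
      using ball t by (simp add: dir_nbhd_basic_def mult_ac)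
  qed
  with \<sigma> \<tau> show ?thesis by blast
qed

text \<open>The regular normals of the defining sequence are lifted one at a time. The base points may move by
  at most \<open>t k / (k + 1)\<close>, so that after division by \<open>t k\<close> the directions still converge to
  \<open>u\<close> with middle coordinate \<open>0\<close>. The error bound makes the new coordinates \<open>v k\<close> bounded by
  \<open>\<kappa> \<parallel>\<xi>' k\<parallel>\<close>, hence relatively compact.\<close>

theorem limiting_normal_slice:
  fixes E :: "(('a::euclidean_space \<times> 'b::euclidean_space) \<times> 'c::euclidean_space) set"
  assumes "closed E" "\<kappa> \<ge> 0" "directional_nbhd u U"
    and err: "\<And>d y. d \<in> U \<Longrightarrow> insert_mid (z0 + d) y \<in> E \<Longrightarrow>
                infdist (z0 + d) {z. insert_mid z ybar \<in> E} \<le> \<kappa> * norm (y - ybar)"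
    and "\<xi> \<in> limiting_normal_cone_dir {z. insert_mid z ybar \<in> E} z0 u"
  obtains y' where "insert_mid \<xi> y' \<in> limiting_normal_cone_dir E (insert_mid z0 ybar) (insert_mid u 0)"
proof -
  let ?C = "{z. insert_mid z ybar \<in> E}"
  obtain t u' \<xi>' where t: "\<And>k. t k > 0" "t \<longlonglongrightarrow> 0" and u': "u' \<longlonglongrightarrow> u" and \<xi>': "\<xi>' \<longlonglongrightarrow> \<xi>"
    and normal: "\<And>k. \<xi>' k \<in> regular_normal_cone ?C (z0 + t k *\<^sub>R u' k)"
    using assms(5) unfolding limiting_normal_cone_dir_def by blast
  obtain \<rho> \<delta> where \<rho>: "\<rho> > 0" and \<delta>: "\<delta> > 0" and U: "dir_nbhd_basic \<rho> \<delta> u \<subseteq> U"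
    using \<open>directional_nbhd u U\<close> unfolding directional_nbhd_def by (elim exE conjE)
  obtain \<sigma> \<tau> where "\<sigma> > 0" "\<tau> > 0" and
    cone: "\<And>t v. 0 < t \<Longrightarrow> t < \<tau> \<Longrightarrow> dist v u < \<sigma> \<Longrightarrow> t *\<^sub>R v \<in> dir_nbhd_basic \<rho> \<delta> u"
    using dir_nbhd_basic_contains_truncated_cone[OF \<rho> \<delta>, of u] by metis
  have "\<forall>\<^sub>F k in sequentially. t k < \<tau> \<and> dist (u' k) u < \<sigma> / 2"
    using t(2) u' \<open>\<sigma> > 0\<close> \<open>\<tau> > 0\<close>
    by (intro eventually_conj order_tendstoD(2)[OF t(2)] tendstoD) auto
  then obtain K where K: "\<And>k. k \<ge> K \<Longrightarrow> t k < \<tau> \<and> dist (u' k) u < \<sigma> / 2"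
    unfolding eventually_sequentially by blast
  let ?w0 = "\<lambda>k. insert_mid (z0 + t k *\<^sub>R u' k) ybar"
  have "\<exists>w v \<zeta>. dist w (?w0 k) < t k / real (Suc k) \<and> norm v \<le> \<kappa> * norm (\<xi>' k) \<and>
      \<zeta> \<in> regular_normal_cone E w \<and> norm (\<zeta> - insert_mid (\<xi>' k) v) \<le> 2 * (1 / real (Suc k))"
    if "k \<ge> K" for k
  proof -
    have err_k: "infdist z ?C \<le> \<kappa> * norm (y - ybar)"
      if z: "dist z (z0 + t k *\<^sub>R u' k) < t k * (\<sigma> / 2)" "insert_mid z y \<in> E" for z y
    proof -
      define v where "v = (z - z0) /\<^sub>R t k"
      have z_eq: "z = z0 + t k *\<^sub>R v" using t(1)[of k] by (simp add: v_def)
      have "t k * dist v (u' k) < t k * (\<sigma> / 2)"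
        using z(1) t(1)[of k] by (simp add: z_eq dist_norm flip: scaleR_diff_right)
      then have "dist v (u' k) < \<sigma> / 2" using t(1)[of k] by simp
      with K[OF \<open>k \<ge> K\<close>] have "dist v u < \<sigma>" using dist_triangle[of v u "u' k"] by simp
      then have "t k *\<^sub>R v \<in> U"
        using cone[of "t k" v] t(1) K[OF \<open>k \<ge> K\<close>] U by (intro subsetD[OF U]) auto
      then show ?thesis using err z(2) by (simp add: z_eq)
    qed
    have pos: "t k * (\<sigma> / 2) > 0" "1 / real (Suc k) > 0" "t k / real (Suc k) > 0"
      using t(1)[of k] \<open>\<sigma> > 0\<close> by simp_all
    show ?thesis
      by (rule slice_normal_imp_nearby_normal[OF \<open>closed E\<close> normal pos(1,2) \<open>\<kappa> \<ge> 0\<close> err_k pos(3)])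
         (assumption | blast)+
  qed
  then have "\<forall>k. \<exists>w v \<zeta>. k \<ge> K \<longrightarrow> dist w (?w0 k) < t k / real (Suc k) \<and> norm v \<le> \<kappa> * norm (\<xi>' k) \<and>
      \<zeta> \<in> regular_normal_cone E w \<and> norm (\<zeta> - insert_mid (\<xi>' k) v) \<le> 2 * (1 / real (Suc k))"
    by blast
  then obtain w v \<zeta> where
    w: "\<And>k. k \<ge> K \<Longrightarrow> dist (w k) (?w0 k) < t k / real (Suc k)" and
    v: "\<And>k. k \<ge> K \<Longrightarrow> norm (v k) \<le> \<kappa> * norm (\<xi>' k)" and
    \<zeta>: "\<And>k. k \<ge> K \<Longrightarrow> \<zeta> k \<in> regular_normal_cone E (w k)" and
    \<zeta>_near: "\<And>k. k \<ge> K \<Longrightarrow> norm (\<zeta> k - insert_mid (\<xi>' k) (v k)) \<le> 2 * (1 / real (Suc k))"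
    by metis
  obtain M where M: "\<And>k. norm (\<xi>' k) \<le> M"
    using Bseq_eq_bounded convergent_imp_Bseq[OF convergentI[OF \<xi>']] unfolding Bseq_def by blast
  have "v (k + K) \<in> cball 0 (\<kappa> * M)" for k
    using v[of "k + K"] mult_left_mono[OF M \<open>\<kappa> \<ge> 0\<close>, of "k + K"] by simp
  then obtain y' \<phi> where \<phi>: "strict_mono \<phi>" and y': "((\<lambda>k. v (k + K)) \<circ> \<phi>) \<longlonglongrightarrow> y'"
    using compact_imp_seq_compact[OF compact_cball[of "0 :: 'b" "\<kappa> * M"], THEN seq_compactE,
        of "\<lambda>k. v (k + K)"] by metis
  \<comment> \<open>The lifts exist only from index \<open>K\<close> on, so the subsequence is shifted.\<close>
  define \<psi> where "\<psi> k = \<phi> k + K" for k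
  have \<psi>K: "\<psi> k \<ge> K" for k by (simp add: \<psi>_def)
  have \<psi>: "filterlim \<psi> sequentially sequentially"
    unfolding \<psi>_def
    by (intro filterlim_at_top_mono[OF filterlim_subseq[OF \<phi>]]) auto
  have inv: "(\<lambda>k. 1 / real (Suc (\<psi> k))) \<longlonglongrightarrow> 0"
    using filterlim_compose[OF LIMSEQ_inverse_real_of_nat \<psi>] by (simp add: inverse_eq_divide)
  define d where "d k = (w (\<psi> k) - insert_mid z0 ybar) /\<^sub>R t (\<psi> k)" for k
  have "(\<lambda>k. d k - insert_mid (u' (\<psi> k)) 0) \<longlonglongrightarrow> 0"
  proof (rule Lim_null_comparison[OF _ inv], intro always_eventually allI)
    fix k
    let ?j = "\<psi> k"
    have "insert_mid z0 ybar + t ?j *\<^sub>R insert_mid (u' ?j) 0 = ?w0 ?j"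
      by (simp add: insert_mid_scaleR insert_mid_add)
    then have "d k - insert_mid (u' ?j) 0 = (w ?j - ?w0 ?j) /\<^sub>R t ?j"
      using t(1)[of ?j] by (simp add: d_def algebra_simps flip: \<open>_ = ?w0 ?j\<close>)
    then have "norm (d k - insert_mid (u' ?j) 0) = dist (w ?j) (?w0 ?j) / t ?j"
      using t(1)[of ?j] by (simp add: dist_norm divide_inverse mult.commute)
    also have "\<dots> \<le> 1 / real (Suc ?j)"
      using w[OF \<psi>K[of k]] t(1)[of ?j] by (simp add: field_simps)
    finally show "norm (d k - insert_mid (u' ?j) 0) \<le> 1 / real (Suc ?j)" .
  qed
  moreover have "(\<lambda>k. insert_mid (u' (\<psi> k)) 0) \<longlonglongrightarrow> insert_mid u (0 :: 'b)"
    by (intro tendsto_intros filterlim_compose[OF u' \<psi>])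
  ultimately have d_lim: "d \<longlonglongrightarrow> insert_mid u 0"
    by (rule Lim_transform[rotated])
  have "(\<lambda>k. \<zeta> (\<psi> k) - insert_mid (\<xi>' (\<psi> k)) (v (\<psi> k))) \<longlonglongrightarrow> 0"
  proof (rule Lim_null_comparison[OF always_eventually])
    show "\<forall>k. norm (\<zeta> (\<psi> k) - insert_mid (\<xi>' (\<psi> k)) (v (\<psi> k))) \<le> 2 * (1 / real (Suc (\<psi> k)))"
      using \<zeta>_near[OF \<psi>K] by blast
    show "(\<lambda>k. 2 * (1 / real (Suc (\<psi> k)))) \<longlonglongrightarrow> 0"
      using tendsto_mult_right_zero[OF inv] .
  qed
  moreover have "(\<lambda>k. insert_mid (\<xi>' (\<psi> k)) (v (\<psi> k))) \<longlonglongrightarrow> insert_mid \<xi> y'"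
    using y' by (intro tendsto_intros filterlim_compose[OF \<xi>' \<psi>]) (simp add: \<psi>_def o_def)
  ultimately have \<zeta>_lim: "(\<lambda>k. \<zeta> (\<psi> k)) \<longlonglongrightarrow> insert_mid \<xi> y'"
    by (rule Lim_transform[rotated])
  have "insert_mid z0 ybar + t (\<psi> k) *\<^sub>R d k = w (\<psi> k)" for k
    using t(1)[of "\<psi> k"] by (simp add: d_def)
  then have "insert_mid \<xi> y' \<in> limiting_normal_cone_dir E (insert_mid z0 ybar) (insert_mid u 0)"
    unfolding limiting_normal_cone_dir_def
    using t(1) filterlim_compose[OF t(2) \<psi>] d_lim \<zeta>_lim \<zeta>[OF \<psi>K]
    by (intro CollectI exI[of _ "\<lambda>k. t (\<psi> k)"] exI[of _ d] exI[of _ "\<lambda>k. \<zeta> (\<psi> k)"]) simp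
  then show thesis by (rule that)
qed

section \<open>Epigraphs\<close>

text \<open>If \<open>\<alpha> < b < f x\<close>, then \<open>f\<close> stays above \<open>b\<close> near \<open>x\<close>, so a product of neighbourhoods of \<open>x\<close> and
  \<open>\<alpha>\<close> misses the epigraph.\<close>

lemma closed_epi:
  fixes f :: "'a::metric_space \<Rightarrow> ereal"
  assumes "lower_semicontinuous f"
  shows "closed (epi f)"
proof -
  have "open (- epi f)"
  proof (rule Topological_Spaces.openI)
    fix p assume "p \<in> - epi f"
    then obtain x \<alpha> where p: "p = (x, \<alpha>)" and "ereal \<alpha> < f x"
      by (cases p) (auto simp: epi_def)
    then obtain b where b: "ereal \<alpha> < ereal b" "ereal b < f x"
      using ereal_dense2[of "ereal \<alpha>" "f x"] by blast
    have "ereal b < Liminf (at x) f"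
      using assms b(2) unfolding lower_semicontinuous_def by (metis less_le_trans)
    then have "\<forall>\<^sub>F x' in at x. ereal b < f x'"
      by (rule less_LiminfD)
    then obtain S where S: "open S" "x \<in> S" "\<And>x'. x' \<in> S \<Longrightarrow> x' \<noteq> x \<Longrightarrow> ereal b < f x'"
      unfolding eventually_at_topological by blast
    have "S \<times> {..<b} \<subseteq> - epi f"
    proof clarify
      fix x' \<beta> assume "x' \<in> S" "\<beta> < b" "(x', \<beta>) \<in> epi f"
      have "ereal b < f x'"
        using S(3)[OF \<open>x' \<in> S\<close>] b(2) by (cases "x' = x") auto
      also have "f x' \<le> ereal \<beta>"
        using \<open>(x', \<beta>) \<in> epi f\<close> by (simp add: epi_def)
      finally show False using \<open>\<beta> < b\<close> by simp
    qed
    moreover have "open (S \<times> {..<b})" "p \<in> S \<times> {..<b}"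
      using S b(1) p by (auto intro: open_Times)
    ultimately show "\<exists>T. open T \<and> p \<in> T \<and> T \<subseteq> - epi f"
      by blast
  qed
  then show ?thesis by (simp add: closed_def)
qed

text \<open>This includes the empty set, where \<open>infdist\<close> is \<open>0\<close> and \<open>edist_set\<close> is \<open>\<infinity>\<close>.\<close>

lemma infdist_le_edist_set:
  "ereal (infdist x A) \<le> edist_set x A"
  unfolding edist_set_def by (intro INF_greatest) (simp add: infdist_le)

lemma edist_set_le: "a \<in> A \<Longrightarrow> edist_set x A \<le> ereal (dist x a)"
  unfolding edist_set_def by (rule INF_lower)

theorem corollary4p4:
  fixes f :: "(real ^ 'n) \<times> (real ^ 'l) \<Rightarrow> ereal"
    and xbar h :: "real ^ 'n" and ybar :: "real ^ 'l" and \<nu> :: real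
    and F :: "(real ^ 'n) \<times> real \<Rightarrow> (((real ^ 'n) \<times> (real ^ 'l)) \<times> real) set"
  assumes "lower_semicontinuous f"
    and "\<bar>f (xbar, ybar)\<bar> \<noteq> \<infinity>"
    and F_def: "\<And>x \<alpha>. F (x, \<alpha>) = {p - ((x, ybar), \<alpha>) | p. p \<in> epi f}"
    and "metrically_subregular_dir F (xbar, real_of_ereal (f (xbar, ybar))) ((0, 0), 0) (h, \<nu>)"
  shows "partial_subdifferential_dir f (xbar, ybar) (h, \<nu>)
           \<subseteq> {x'. \<exists>y'. (x', y') \<in> subdifferential_dir f (xbar, ybar) ((h, 0), \<nu>)}"
proof
  fix x' assume x': "x' \<in> partial_subdifferential_dir f (xbar, ybar) (h, \<nu>)"
  let ?C = "{z. insert_mid z ybar \<in> epi f}"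
  define z0 where "z0 = (xbar, real_of_ereal (f (xbar, ybar)))"
  have F: "F z = (\<lambda>p. p - insert_mid z ybar) ` epi f" for z
    using F_def[of "fst z" "snd z"] unfolding insert_mid_def image_def prod.collapse by blast
  have "((0, 0), 0) \<in> F z \<longleftrightarrow> z \<in> ?C" for z
    unfolding F by (auto simp: image_iff zero_prod_def[symmetric])
  then have C: "{z. ((0, 0), 0) \<in> F z} = ?C" by blast
  obtain \<kappa> U where "\<kappa> > 0" and U: "directional_nbhd (h, \<nu>) U" and
    sub: "\<And>z. z \<in> (+) z0 ` U \<Longrightarrow> edist_set z ?C \<le> ereal \<kappa> * edist_set ((0, 0), 0) (F z)"
    using assms(4) unfolding metrically_subregular_dir_def C z0_def[symmetric] by meson
  \<comment> \<open>The point \<open>(z0 + d, y)\<close> of \<open>epi f\<close> is a competitor in the distance of \<open>0\<close> to \<open>F (z0 + d)\<close>, at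
    distance \<open>\<parallel>y - ybar\<parallel>\<close>.\<close>
  have err: "infdist (z0 + d) ?C \<le> \<kappa> * norm (y - ybar)"
    if d: "d \<in> U" "insert_mid (z0 + d) y \<in> epi f" for d y
  proof -
    have "insert_mid 0 (y - ybar) \<in> F (z0 + d)"
      unfolding F using d(2) by (intro image_eqI[of _ _ "insert_mid (z0 + d) y"]) (auto simp: insert_mid_diff)
    then have "edist_set ((0, 0), 0) (F (z0 + d)) \<le> ereal (dist ((0, 0), 0) (insert_mid (0 :: (real^'n) \<times> real) (y - ybar)))"
      by (rule edist_set_le)
    also have "dist ((0, 0), 0) (insert_mid (0 :: (real^'n) \<times> real) (y - ybar)) = norm (y - ybar)"
      by (simp add: insert_mid_def dist_Pair_Pair dist_norm norm_minus_commute)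
    finally have "ereal \<kappa> * edist_set ((0, 0), 0) (F (z0 + d)) \<le> ereal \<kappa> * ereal (norm (y - ybar))"
      using \<open>\<kappa> > 0\<close> by (intro ereal_mult_left_mono) auto
    with sub[of "z0 + d"] d(1) infdist_le_edist_set[of "z0 + d" ?C]
    have "ereal (infdist (z0 + d) ?C) \<le> ereal \<kappa> * ereal (norm (y - ybar))"
      by (meson imageI order_trans)
    then show ?thesis by simp
  qed
  have "epi (\<lambda>x. f (x, ybar)) = ?C"
    by (auto simp: epi_def insert_mid_def)
  then have "(x', -1) \<in> limiting_normal_cone_dir ?C z0 (h, \<nu>)"
    using x' by (simp add: partial_subdifferential_dir_def subdifferential_dir_def z0_def)
  then obtain y' where
    "insert_mid (x', -1) y' \<in> limiting_normal_cone_dir (epi f) (insert_mid z0 ybar) (insert_mid (h, \<nu>) 0)"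
    using limiting_normal_slice[OF closed_epi[OF assms(1)] _ U err] \<open>\<kappa> > 0\<close> by auto
  then show "x' \<in> {x'. \<exists>y'. (x', y') \<in> subdifferential_dir f (xbar, ybar) ((h, 0), \<nu>)}"
    by (auto simp: subdifferential_dir_def insert_mid_def z0_def)
qed

end
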